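(* For each $k\in\mathbb{N}$, the sequence (indexed by $m\ge 1$) of sequences $$\big((S_1(m)\bmod k,\ S_2(m)\bmod k,\ S_3(m)\bmod k,\ \dots)\big)_{m\ge 1}$$ is periodic. If $k=q_1^{a_1}q_2^{a_2}\cdots q_r^{a_r}$ where the $q_i$ are distinct primes, then its (least) period is $q_1^{a_1+1}q_2^{a_2+1}\cdots q_r^{a_r+1}$.
   Context: $\mathbb{N}$ denotes the positive integers. $S_n(m)=\sum_{i=1}^m i^n$. Each term of the outer sequence is the infinite sequence $(S_n(m)\bmod k)_{n\ge 1}$; periodicity means there is $L\ge1$ with these infinite sequences equal for $m$ and $m+L$ for all $m\ge1$, and the period is the least such $L$. *)

theory Defs
  imports "HOL-Computational_Algebra.Primes" "HOL-Library.FuncSet"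
begin

definition power_sum :: "nat \<Rightarrow> nat \<Rightarrow> nat" where
  "power_sum n m = (\<Sum>i=1..m. i ^ n)"

text \<open>The inner sequences are indexed by \<open>n \<ge> 1\<close>; restricting to \<open>{1..}\<close> makes equality of
  functions coincide with equality of these sequences, so that \<open>n = 0\<close> plays no role.\<close>

definition power_sums_mod :: "nat \<Rightarrow> nat \<Rightarrow> (nat \<Rightarrow> nat)" where
  "power_sums_mod k m = (\<lambda>n\<in>{1..}. power_sum n m mod k)"

text \<open>Sequences indexed by \<open>m \<ge> 1\<close>: the value at \<open>0\<close> is ignored.\<close>

definition is_period :: "(nat \<Rightarrow> 'a) \<Rightarrow> nat \<Rightarrow> bool" where
  "is_period f L \<longleftrightarrow> L \<ge> 1 \<and> (\<forall>m\<ge>1. f (m + L) = f m)"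

definition periodic_seq :: "(nat \<Rightarrow> 'a) \<Rightarrow> bool" where
  "periodic_seq f \<longleftrightarrow> (\<exists>L. is_period f L)"

definition least_period :: "(nat \<Rightarrow> 'a) \<Rightarrow> nat" where
  "least_period f = (LEAST L. is_period f L)"

end

theory Submission
  imports Defs "HOL-Number_Theory.Residues"
begin

text \<open>A number \<open>L \<ge> 1\<close> is a period iff \<open>k\<close> divides every sum of \<open>n\<close>-th powers of \<open>L\<close> consecutive
  integers exceeding \<open>1\<close>. For a prime \<open>p\<close>, a sum over \<open>p ^ (a + 1)\<close> consecutive integers is
  divisible by \<open>p ^ a\<close>: cut it into \<open>p\<close> blocks that agree modulo \<open>p ^ a\<close> and induct on \<open>a\<close>.
  Conversely, let \<open>L\<close> be a period and \<open>p ^ a\<close> divide \<open>k\<close>. The exponent \<open>n = 1\<close> gives \<open>p ^ a dvd L\<close>.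
  For \<open>n = a * totient (p ^ a)\<close>, every \<open>n\<close>-th power is \<open>0\<close> or \<open>1\<close> modulo \<open>p ^ a\<close> according to
  whether \<open>p\<close> divides its base, so the sum counts the \<open>(L div p) * (p - 1)\<close> non-multiples
  of \<open>p\<close>; hence \<open>p ^ a\<close> divides \<open>L div p\<close>.\<close>

lemma sum_lessThan_mult:
  fixes f :: "nat \<Rightarrow> 'a::comm_monoid_add"
  shows "(\<Sum>i<d * e. f i) = (\<Sum>j<e. \<Sum>i<d. f (j * d + i))"
proof (induction e)
  case (Suc e)
  have "{..<d * Suc e} = {..<d * e} \<union> {d * e..<d * e + d}" by auto
  then have "(\<Sum>i<d * Suc e. f i) = (\<Sum>i<d * e. f i) + (\<Sum>i=d * e..<d * e + d. f i)"
    by (simp add: sum.union_disjoint ivl_disj_int)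
  also have "(\<Sum>i=d * e..<d * e + d. f i) = (\<Sum>i<d. f (e * d + i))"
    using sum.shift_bounds_nat_ivl[of f 0 "d * e" d]
    by (simp add: ac_simps atLeast0LessThan)
  finally show ?case using Suc by simp
qed simp

text \<open>Bases in different blocks of length \<open>d\<close> differ by multiples of
  \<open>d\<close>, so all \<open>e\<close> blocks have the same residue.\<close>

lemma cong_sum_powers_blocks:
  fixes c d e n :: nat
  shows "[(\<Sum>i<d * e. (c + i) ^ n) = e * (\<Sum>i<d. (c + i) ^ n)] (mod d)"
proof -
  have "[(\<Sum>j<e. \<Sum>i<d. (c + (j * d + i)) ^ n) = (\<Sum>j<e. \<Sum>i<d. (c + i) ^ n)] (mod d)"
  proof (intro cong_sum cong_pow)
    fix i j :: nat
    show "[c + (j * d + i) = c + i] (mod d)"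
      using cong_add_lcancel_0_nat[of "c + i" "j * d" d]
      by (simp add: cong_0_iff ac_simps)
  qed
  then show ?thesis by (simp add: sum_lessThan_mult)
qed

lemma power_dvd_sum_powers:
  fixes p a c n :: nat
  shows "p ^ a dvd (\<Sum>i<p ^ (a + 1). (c + i) ^ n)"
proof (induction a)
  case (Suc a)
  have "p ^ (Suc a + 1) = p ^ Suc a * p" by simp
  then have "[(\<Sum>i<p ^ (Suc a + 1). (c + i) ^ n) = p * (\<Sum>i<p ^ Suc a. (c + i) ^ n)]
      (mod p ^ Suc a)"
    by (simp only: cong_sum_powers_blocks)
  \<comment> \<open>The outer \<open>p\<close> counts the blocks; the induction hypothesis supplies
    the remaining \<open>p ^ a\<close>.\<close>
  moreover have "p ^ Suc a dvd p * (\<Sum>i<p ^ Suc a. (c + i) ^ n)"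
    using Suc by simp
  ultimately show ?case
    using cong_dvd_iff by blast
qed simp

lemma power_sum_add: "power_sum n (m + L) = power_sum n m + (\<Sum>i<L. (m + 1 + i) ^ n)"
  by (induction L) (simp_all add: power_sum_def)

lemma is_period_power_sums_mod_iff:
  "is_period (power_sums_mod k) L \<longleftrightarrow>
     L \<ge> 1 \<and> (\<forall>m\<ge>1. \<forall>n\<ge>1. k dvd (\<Sum>i<L. (m + 1 + i) ^ n))"
proof -
  have "power_sums_mod k (m + L) = power_sums_mod k m \<longleftrightarrow>
      (\<forall>n\<ge>1. k dvd (\<Sum>i<L. (m + 1 + i) ^ n))" for m
  proof -
    have "power_sums_mod k (m + L) = power_sums_mod k m \<longleftrightarrow>
        (\<forall>n\<ge>1. [power_sum n (m + L) = power_sum n m] (mod k))"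
      unfolding power_sums_mod_def fun_eq_iff cong_def by (auto simp: restrict_def)
    then show ?thesis
      by (simp add: power_sum_add cong_add_lcancel_0_nat cong_0_iff)
  qed
  then show ?thesis
    by (simp add: is_period_def)
qed

lemma prod_coprime_dvd:
  fixes f :: "'b \<Rightarrow> 'a::semiring_gcd"
  assumes "finite A" "\<And>i. i \<in> A \<Longrightarrow> f i dvd x"
    and "\<And>i j. i \<in> A \<Longrightarrow> j \<in> A \<Longrightarrow> i \<noteq> j \<Longrightarrow> coprime (f i) (f j)"
  shows "prod f A dvd x"
  using assms
proof (induction A rule: finite_induct)
  case (insert i A)
  have "coprime (f i) (prod f A)"
    using insert by (intro prod_coprime_right) auto
  then show ?case
    using insert by (simp add: divides_mult)
qed simp

text \<open>The factor \<open>totient (p ^ a)\<close> serves Euler's theorem for bases prime to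
  \<open>p\<close>; the factor \<open>a\<close> makes the exponent at least \<open>a\<close>, which
  kills multiples of \<open>p\<close>.\<close>

lemma cong_power_totient_indicator:
  fixes p a i :: nat
  assumes "prime p" "a \<ge> 1"
  shows "[i ^ (a * totient (p ^ a)) = of_bool (\<not> p dvd i)] (mod p ^ a)"
proof (cases "p dvd i")
  case True
  have "totient (p ^ a) \<ge> 1"
    using assms by (simp add: Suc_le_eq prime_gt_0_nat)
  then have "p ^ a dvd i ^ (a * totient (p ^ a))"
    by (intro dvd_power_le True) simp
  with True show ?thesis by (simp add: cong_0_iff)
next
  case False
  then have "coprime i (p ^ a)"
    using assms prime_imp_coprime[of p i] by (simp add: coprime_commute)
  then have "[i ^ totient (p ^ a) = 1] (mod p ^ a)"
    by (rule euler_theorem)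
  from cong_pow[OF this, of a] False show ?thesis
    by (simp add: power_mult[symmetric] mult.commute)
qed

lemma sum_of_bool_not_dvd:
  fixes p t :: nat
  assumes "p \<ge> 1"
  shows "(\<Sum>i<p * t. of_bool (\<not> p dvd i)) = t * (p - 1)"
proof -
  have "(\<Sum>i<p. of_bool (\<not> p dvd i)) = (\<Sum>i\<in>{..<p} - {0}. 1::nat)"
    using assms by (intro sum.mono_neutral_cong_right) (auto dest: dvd_imp_le)
  also have "\<dots> = p - 1"
    using assms by (simp add: card_Diff_singleton)
  finally have "(\<Sum>i<p. of_bool (\<not> p dvd i)) = p - 1" .
  then show ?thesis
    by (simp add: sum_lessThan_mult)
qed

lemma prime_power_dvd_period:
  assumes per: "is_period (power_sums_mod k) L"
    and p: "prime p" and a: "a \<ge> 1" and dvd: "p ^ a dvd k"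
  shows "p ^ (a + 1) dvd L"
proof -
  have block: "p ^ a dvd (\<Sum>i<L. (m + 1 + i) ^ n)" if "m \<ge> 1" "n \<ge> 1" for m n
    using per that dvd_trans[OF dvd] unfolding is_period_power_sums_mod_iff by blast
  \<comment> \<open>Moving the block from start 2 to start 3 raises each of its \<open>L\<close>
    terms by 1.\<close>
  have "(\<Sum>i<L. (2 + 1 + i) ^ 1) = (\<Sum>i<L. (1 + 1 + i) ^ 1) + L"
    by (induction L) simp_all
  with block[of 1 1] block[of 2 1] have "p ^ a dvd L"
    by (simp add: dvd_add_right_iff)
  with a have "p dvd L"
    using dvd_power[of a p] dvd_trans by fastforce
  then obtain t where t: "L = p * t" by blast
  define n where "n = a * totient (p ^ a)"
  have "n \<ge> 1"
    using p a by (simp add: n_def Suc_le_eq prime_gt_0_nat)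
  \<comment> \<open>The block starts at \<open>p \<ge> 2\<close>, so that it begins with a multiple of \<open>p\<close>.\<close>
  with block[of "p - 1" n] prime_ge_2_nat[OF p] have "p ^ a dvd (\<Sum>i<L. (p + i) ^ n)"
    by simp
  moreover have "[(\<Sum>i<L. (p + i) ^ n) = (\<Sum>i<L. of_bool (\<not> p dvd p + i))] (mod p ^ a)"
    unfolding n_def by (intro cong_sum cong_power_totient_indicator p a)
  moreover have "(\<Sum>i<L. of_bool (\<not> p dvd p + i)) = t * (p - 1)"
    using sum_of_bool_not_dvd[OF prime_ge_1_nat[OF p]]
    by (simp only: t dvd_add_right_iff[OF dvd_refl])
  ultimately have "p ^ a dvd t * (p - 1)"
    using cong_dvd_iff by metis
  moreover have "coprime (p ^ a) (p - 1)"
    using coprime_diff_one_right_nat[OF prime_gt_0_nat[OF p]] by simp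
  ultimately have "p ^ a dvd t"
    by (simp add: coprime_dvd_mult_left_iff)
  then show ?thesis by (simp add: t)
qed

text \<open>A crude period that gives periodicity without factorising \<open>k\<close>: the sum
  consists of \<open>k\<close> blocks congruent modulo \<open>k\<close>.\<close>

lemma is_period_power_sums_mod_square:
  assumes "k \<ge> 1"
  shows "is_period (power_sums_mod k) (k * k)"
proof -
  have "k dvd (\<Sum>i<k * k. (c + i) ^ n)" for c n
    using cong_dvd_iff[OF cong_sum_powers_blocks[of c n k k]] by simp
  moreover have "k * k \<ge> 1"
    using assms by simp
  ultimately show ?thesis
    unfolding is_period_power_sums_mod_iff by blast
qed

lemma least_period_power_sums_mod:
  fixes q a :: "nat \<Rightarrow> nat"
  assumes inj: "inj_on q {1..r}"
    and q: "\<And>i. i \<in> {1..r} \<Longrightarrow> prime (q i)" and a: "\<And>i. i \<in> {1..r} \<Longrightarrow> a i \<ge> 1"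
    and k: "k = (\<Prod>i=1..r. q i ^ a i)"
  shows "least_period (power_sums_mod k) = (\<Prod>i=1..r. q i ^ (a i + 1))"
proof -
  define P where "P = (\<Prod>i=1..r. q i ^ (a i + 1))"
  have coprime: "coprime (q i ^ b) (q j ^ c)" if "i \<in> {1..r}" "j \<in> {1..r}" "i \<noteq> j" for i j b c
    using that inj q by (auto intro!: primes_coprime dest: inj_onD)
  have "P \<ge> 1"
    unfolding P_def by (intro prod_ge_1 one_le_power prime_ge_1_nat q)
  have "k dvd (\<Sum>i<P. (c + i) ^ n)" for c n
    unfolding k
  proof (intro prod_coprime_dvd)
    fix j assume j: "j \<in> {1..r}"
    let ?d = "q j ^ (a j + 1)"
    have "?d dvd P"
      unfolding P_def using j by (intro dvd_prodI) auto
    then obtain t where t: "P = ?d * t" by blast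
    \<comment> \<open>The blocks of length \<open>?d\<close> agree modulo \<open>?d\<close>, hence
      modulo its divisor \<open>q j ^ a j\<close>.\<close>
    have "[(\<Sum>i<P. (c + i) ^ n) = t * (\<Sum>i<?d. (c + i) ^ n)] (mod q j ^ a j)"
      unfolding t by (rule cong_dvd_modulus_nat[OF cong_sum_powers_blocks]) simp
    moreover have "q j ^ a j dvd t * (\<Sum>i<?d. (c + i) ^ n)"
      by (intro dvd_mult power_dvd_sum_powers)
    ultimately show "q j ^ a j dvd (\<Sum>i<P. (c + i) ^ n)"
      using cong_dvd_iff by blast
  qed (use coprime in auto)
  with \<open>P \<ge> 1\<close> have "is_period (power_sums_mod k) P"
    unfolding is_period_power_sums_mod_iff by blast
  moreover have "P \<le> L" if L: "is_period (power_sums_mod k) L" for L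
  proof -
    \<comment> \<open>Unlike the bound \<open>P \<le> L\<close>, divisibility can be checked one
      prime at a time.\<close>
    have "P dvd L"
      unfolding P_def
    proof (intro prod_coprime_dvd)
      fix j assume j: "j \<in> {1..r}"
      then have "q j ^ a j dvd k"
        unfolding k by (intro dvd_prodI) auto
      with L j show "q j ^ (a j + 1) dvd L"
        by (intro prime_power_dvd_period q a)
    qed (use coprime in auto)
    with L show ?thesis
      by (simp add: is_period_def dvd_imp_le)
  qed
  ultimately show ?thesis
    unfolding least_period_def P_def[symmetric] by (rule Least_equality)
qed

theorem theorem8:
  fixes k :: nat
  assumes "k \<ge> 1"
  shows "periodic_seq (power_sums_mod k) \<and>
    (\<forall>(r::nat) (q :: nat \<Rightarrow> nat) (a :: nat \<Rightarrow> nat).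
       inj_on q {1..r} \<and> (\<forall>i\<in>{1..r}. prime (q i) \<and> a i \<ge> 1) \<and>
       k = (\<Prod>i=1..r. q i ^ a i) \<longrightarrow>
       least_period (power_sums_mod k) = (\<Prod>i=1..r. q i ^ (a i + 1)))"
proof (intro conjI allI impI)
  show "periodic_seq (power_sums_mod k)"
    unfolding periodic_seq_def using is_period_power_sums_mod_square[OF assms] by blast
qed (rule least_period_power_sums_mod, auto)

end
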